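(* For every integer $n\geq 3$, writing $f_q(n)$ for the total number of occurrences of the pattern $q$ in all permutations of $S_n(123,132)$, we have $$f_{213}(n)=(n-3)2^{n-2}+1,$$ $$f_{231}(n)=f_{312}(n)=(n^2-5n+8)2^{n-3}-1,$$ $$f_{321}(n)=\left(\frac{n^3}{3}-2n^2+\frac{14n}{3}-5\right)2^{n-2}+1.$$
   Context: $S_n$ is the set of permutations of $\{1,\dots,n\}$ written in one-line notation $\sigma=\sigma_1\sigma_2\cdots\sigma_n$. For $q\in S_k$, an occurrence of the pattern $q$ in $\sigma\in S_n$ is a choice of indices $i_1<i_2<\cdots<i_k$ in $\{1,\dots,n\}$ such that for all $1\le j,l\le k$, $q_j<q_l$ if and only if $\sigma_{i_j}<\sigma_{i_l}$. Let $f_q(\sigma)$ be the number of occurrences of $q$ in $\sigma$; $\sigma$ avoids $q$ if $f_q(\sigma)=0$. $S_n(123,132)$ is the set of permutations in $S_n$ avoiding both $123$ and $132$, and $f_q(n)=\sum_{\sigma\in S_n(123,132)}f_q(\sigma)$. *)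

theory Defs
  imports Complex_Main "HOL-Combinatorics.Multiset_Permutations"
begin

text \<open>
  A permutation of \<open>{1..n}\<close> is given by its one-line notation, as the list of its values:
  the set \<open>S\<^sub>n\<close> is \<open>permutations_of_set {1..n}\<close>. Patterns are written in the same way, so that
  \<open>[2, 1, 3]\<close> is the pattern 213. The values are 1-based, whereas the positions in a list are
  0-based.
\<close>

text \<open>The index list \<open>is\<close> is the choice \<open>i\<^sub>1 < \<dots> < i\<^sub>k\<close> of positions in \<open>s\<close>.\<close>

definition occurrences :: "nat list \<Rightarrow> nat list \<Rightarrow> nat list set" where
  "occurrences q s =
    {is. length is = length q \<and> sorted_wrt (<) is \<and> set is \<subseteq> {..<length s} \<and>
      (\<forall>j<length q. \<forall>l<length q. q ! j < q ! l \<longleftrightarrow> s ! (is ! j) < s ! (is ! l))}"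

lemma finite_occurrences: "finite (occurrences q s)"
  by (rule finite_subset[OF _ finite_lists_length_eq[of "{..<length s}" "length q"]])
    (auto simp: occurrences_def)

definition pattern_count :: "nat list \<Rightarrow> nat list \<Rightarrow> nat" where
  "pattern_count q s = card (occurrences q s)"

definition avoids :: "nat list \<Rightarrow> nat list \<Rightarrow> bool" where
  "avoids s q \<longleftrightarrow> pattern_count q s = 0"

definition Av_123_132 :: "nat \<Rightarrow> nat list set" where
  "Av_123_132 n =
    {s \<in> permutations_of_set {1..n}. avoids s [1, 2, 3] \<and> avoids s [1, 3, 2]}"

definition total_count :: "nat list \<Rightarrow> nat \<Rightarrow> nat" where
  "total_count q n = (\<Sum>s\<in>Av_123_132 n. pattern_count q s)"

end

theory Submission
  imports Defs
begin

text \<open>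
  A permutation avoids both 123 and 132 iff every entry has at most one larger entry to its right.
  Hence the first entry of such a permutation of \<open>{1..n+1}\<close> is \<open>n+1\<close> or \<open>n\<close>, and the rest is order
  isomorphic to an arbitrary such permutation \<open>t\<close> of \<open>{1..n}\<close>. The occurrences of a pattern of
  length 3 that use the new first entry are pairs of entries of \<open>t\<close>, counted by the numbers of ascents
  and descents (not necessarily adjacent) of \<open>t\<close> and by the position of its maximum. The totals
  therefore satisfy linear recurrences, which the closed forms solve.
\<close>

section \<open>Counting pairs and triples of entries\<close>

text \<open>Recursion on the first entry, rather than on index sets, makes prepending an entry add
  exactly one summand to the count.\<close>

fun pairs :: "('a \<Rightarrow> 'a \<Rightarrow> bool) \<Rightarrow> 'a list \<Rightarrow> nat" where
  "pairs R [] = 0"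
| "pairs R (x # t) = length (filter (R x) t) + pairs R t"

fun triples :: "('a \<Rightarrow> 'a \<Rightarrow> 'a \<Rightarrow> bool) \<Rightarrow> 'a list \<Rightarrow> nat" where
  "triples T [] = 0"
| "triples T (x # t) = pairs (T x) t + triples T t"

lemma pairs_map: "pairs R (map f s) = pairs (\<lambda>a b. R (f a) (f b)) s"
  by (induction s) (auto simp: filter_map o_def)

lemma triples_map: "triples T (map f s) = triples (\<lambda>a b c. T (f a) (f b) (f c)) s"
  by (induction s) (auto simp: pairs_map)

lemma pairs_cong:
  assumes "distinct s"
    and "\<And>a b. a \<in> set s \<Longrightarrow> b \<in> set s \<Longrightarrow> a \<noteq> b \<Longrightarrow> R a b \<longleftrightarrow> R' a b"
  shows "pairs R s = pairs R' s"
  using assms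
proof (induction s)
  case (Cons x s)
  then have "filter (R x) s = filter (R' x) s"
    by (intro filter_cong) auto
  with Cons show ?case by simp
qed simp

lemma triples_cong:
  assumes "distinct s"
    and "\<And>a b c. a \<in> set s \<Longrightarrow> b \<in> set s \<Longrightarrow> c \<in> set s \<Longrightarrow> T a b c \<longleftrightarrow> T' a b c"
  shows "triples T s = triples T' s"
  using assms
proof (induction s)
  case (Cons x s)
  then have "pairs (T x) s = pairs (T' x) s"
    by (intro pairs_cong) auto
  with Cons show ?case by simp
qed simp

lemma pairs_False [simp]: "pairs (\<lambda>_ _. False) s = 0"
  by (induction s) auto

text \<open>The \<open>of_bool\<close> equation says in one formula that \<open>Q\<close> is the
  disjoint union of \<open>P\<close> and \<open>P'\<close>; the same device serves pairs and triples
  below.\<close>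

lemma length_filter_add:
  assumes "\<And>y. y \<in> set s \<Longrightarrow> of_bool (P y) + of_bool (P' y) = (of_bool (Q y) :: nat)"
  shows "length (filter P s) + length (filter P' s) = length (filter Q s)"
  using assms
proof (induction s)
  case (Cons y s)
  have "of_bool (P y) + of_bool (P' y) = (of_bool (Q y) :: nat)"
    by (rule Cons.prems) simp
  moreover have "length (filter P s) + length (filter P' s) = length (filter Q s)"
    by (rule Cons.IH) (simp add: Cons.prems)
  ultimately show ?case
    by (auto simp: of_bool_def split: if_splits)
qed simp

lemma pairs_add:
  assumes "distinct s"
    and "\<And>a b. a \<in> set s \<Longrightarrow> b \<in> set s \<Longrightarrow> a \<noteq> b \<Longrightarrow>
      of_bool (R a b) + of_bool (R' a b) = (of_bool (Q a b) :: nat)"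
  shows "pairs R s + pairs R' s = pairs Q s"
  using assms
proof (induction s)
  case (Cons x s)
  have "length (filter (R x) s) + length (filter (R' x) s) = length (filter (Q x) s)"
    using Cons.prems(1) by (intro length_filter_add Cons.prems(2)) auto
  with Cons show ?case by simp
qed simp

lemma triples_add:
  assumes "distinct s"
    and "\<And>a b c. distinct [a, b, c] \<Longrightarrow>
      of_bool (T a b c) + of_bool (T' a b c) = (of_bool (Q a b c) :: nat)"
  shows "triples T s + triples T' s = triples Q s"
  using assms(1)
proof (induction s)
  case (Cons x s)
  have "pairs (T x) s + pairs (T' x) s = pairs (Q x) s"
    using Cons.prems by (intro pairs_add assms(2)) auto
  with Cons show ?case by simp
qed simp

text \<open>The binomial coefficient "length choose 2", written without subtraction or
  division.\<close>

lemma pairs_True: "2 * pairs (\<lambda>_ _. True) s + length s = length s ^ 2"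
  by (induction s) (auto simp: power2_eq_square)

text \<open>Two entries satisfying \<open>P\<close> would form a counted pair. With \<open>P\<close>
  meaning "larger than the first entry", this detects the forbidden triples starting there.\<close>

lemma pairs_conj_eq_0: "pairs (\<lambda>a b. P a \<and> P b) s = 0 \<longleftrightarrow> length (filter P s) \<le> 1"
proof (induction s)
  case (Cons x s)
  then show ?case by (cases "P x") auto
qed simp

lemma length_filter_eq:
  assumes "distinct s" "m \<in> set s"
  shows "length (filter (\<lambda>y. y = m) s) = 1"
  using assms by (induction s) (auto simp: filter_empty_conv)

text \<open>The first count is the number of entries after \<open>m\<close>, the second the number
  before it, and 1 stands for \<open>m\<close> itself.\<close>

lemma pairs_around:
  assumes "distinct s" "m \<in> set s"
  shows "pairs (\<lambda>a b. a = m) s + pairs (\<lambda>a b. b = m) s + 1 = length s"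
  using assms
proof (induction s)
  case (Cons x s)
  show ?case
  proof (cases "x = m")
    case True
    with Cons.prems have "m \<notin> set s" by auto
    then have "pairs (\<lambda>a b. a = m) s = 0 \<and> length (filter (\<lambda>y. y = m) s) = 0
        \<and> pairs (\<lambda>a b. b = m) s = 0"
      by (induction s) auto
    with True show ?thesis by simp
  next
    case False
    with Cons show ?thesis by (simp add: length_filter_eq)
  qed
qed simp

section \<open>Occurrences of patterns of length 3\<close>

text \<open>An arbitrary predicate on the selected entries replaces the pattern, so that an already
  chosen first entry can be absorbed into it during induction.\<close>

definition positions :: "nat \<Rightarrow> ('a list \<Rightarrow> bool) \<Rightarrow> 'a list \<Rightarrow> nat list set" where
  "positions k P s = {is. length is = k \<and> sorted_wrt (<) is \<and> set is \<subseteq> {..<length s} \<and>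
     P (map ((!) s) is)}"

lemma finite_positions: "finite (positions k P s)"
  by (rule finite_subset[OF _ finite_lists_length_eq[of "{..<length s}" k]])
    (auto simp: positions_def)

lemma card_positions_0: "card (positions 0 P s) = of_bool (P [])"
proof -
  have "positions 0 P s = (if P [] then {[]} else {})"
    by (auto simp: positions_def)
  then show ?thesis by simp
qed

lemma card_positions_Nil: "card (positions (Suc k) P []) = 0"
  by (auto simp: positions_def)

lemma map_Suc_image:
  assumes "0 \<notin> set is"
  shows "is \<in> range (map Suc)"
proof -
  have "map Suc (map (\<lambda>i. i - 1) is) = is"
    using assms by (induction "is") auto
  then show ?thesis by (metis rangeI)
qed

lemma map_Suc_in_positions:
  "map Suc is \<in> positions k P (x # t) \<longleftrightarrow> is \<in> positions k P t"
  by (auto simp: positions_def sorted_wrt_map o_def)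

lemma Cons_0_map_Suc_in_positions:
  "0 # map Suc is \<in> positions (Suc k) P (x # t) \<longleftrightarrow> is \<in> positions k (\<lambda>ys. P (x # ys)) t"
  by (auto simp: positions_def sorted_wrt_map o_def)

text \<open>Case split on whether position 0 is chosen. By strict increase 0 can only be the head,
  so all other indices are shifts by one.\<close>

lemma positions_Cons:
  "positions (Suc k) P (x # t) =
     (\<lambda>is. 0 # map Suc is) ` positions k (\<lambda>ys. P (x # ys)) t \<union> map Suc ` positions (Suc k) P t"
  (is "?L = ?R")
proof
  show "?L \<subseteq> ?R"
  proof
    fix "is"
    assume *: "is \<in> ?L"
    then obtain i js where is_eq: "is = i # js" and srt: "\<forall>j\<in>set js. i < j"
      by (auto simp: positions_def length_Suc_conv)
    have "0 \<notin> set js"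
      using srt by auto
    then obtain ks where ks: "js = map Suc ks"
      using map_Suc_image by blast
    show "is \<in> ?R"
    proof (cases i)
      case 0
      with * is_eq ks show ?thesis
        using Cons_0_map_Suc_in_positions[of ks k P x t] by auto
    next
      case (Suc i')
      with is_eq ks have is_eq': "is = map Suc (i' # ks)" by simp
      with * have "i' # ks \<in> positions (Suc k) P t"
        by (simp only: map_Suc_in_positions)
      with is_eq' show ?thesis by blast
    qed
  qed
  show "?R \<subseteq> ?L"
    using Cons_0_map_Suc_in_positions map_Suc_in_positions by fast
qed

lemma card_positions_Cons:
  "card (positions (Suc k) P (x # t)) =
     card (positions k (\<lambda>ys. P (x # ys)) t) + card (positions (Suc k) P t)"
  unfolding positions_Cons
  by (subst card_Un_disjoint) (auto simp: finite_positions card_image inj_on_def)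

lemma card_positions_1:
  "card (positions (Suc 0) P s) = length (filter (\<lambda>a. P [a]) s)"
  by (induction s) (auto simp: card_positions_Nil card_positions_Cons card_positions_0)

lemma card_positions_2:
  "card (positions (Suc (Suc 0)) P s) = pairs (\<lambda>a b. P [a, b]) s"
  by (induction s) (auto simp: card_positions_Nil card_positions_Cons card_positions_1)

lemma card_positions_3:
  "card (positions (Suc (Suc (Suc 0))) P s) = triples (\<lambda>a b c. P [a, b, c]) s"
  by (induction s) (auto simp: card_positions_Nil card_positions_Cons card_positions_2)

lemma pattern_count_3:
  "pattern_count [p, q, r] s = triples (\<lambda>a b c.
     \<forall>j<3. \<forall>l<3. [p, q, r] ! j < [p, q, r] ! l \<longleftrightarrow> [a, b, c] ! j < [a, b, c] ! l) s"
proof -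
  have "occurrences [p, q, r] s = positions (Suc (Suc (Suc 0)))
     (\<lambda>ys. \<forall>j<3. \<forall>l<3. [p, q, r] ! j < [p, q, r] ! l \<longleftrightarrow> ys ! j < ys ! l) s"
    unfolding occurrences_def positions_def by (auto simp: numeral_3_eq_3)
  then show ?thesis
    unfolding pattern_count_def by (simp only: card_positions_3)
qed

lemma all_less_3: "(\<forall>j<3. P j) \<longleftrightarrow> P 0 \<and> P (Suc 0) \<and> P (Suc (Suc 0))" for P :: "nat \<Rightarrow> bool"
  by (simp add: numeral_3_eq_3 All_less_Suc conj_ac)

text \<open>The nine comparisons collapse to the chain listing the three entries by increasing
  value, which is the inverse of the pattern.\<close>

lemma pattern_count_simps:
  "pattern_count [1, 2, 3] s = triples (\<lambda>a b c. a < b \<and> b < c) s"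
  "pattern_count [1, 3, 2] s = triples (\<lambda>a b c. a < c \<and> c < b) s"
  "pattern_count [2, 1, 3] s = triples (\<lambda>a b c. b < a \<and> a < c) s"
  "pattern_count [2, 3, 1] s = triples (\<lambda>a b c. c < a \<and> a < b) s"
  "pattern_count [3, 1, 2] s = triples (\<lambda>a b c. b < c \<and> c < a) s"
  "pattern_count [3, 2, 1] s = triples (\<lambda>a b c. c < b \<and> b < a) s"
  unfolding pattern_count_3 all_less_3
  by (rule arg_cong[where f = "\<lambda>T. triples T s"], auto simp: fun_eq_iff)+

section \<open>The recursive structure of the avoiding permutations\<close>

text \<open>When \<open>a\<close> lies below both \<open>b\<close> and \<open>c\<close>, the order
  of \<open>b\<close> and \<open>c\<close> decides between 123 and 132, so the two counts add
  up.\<close>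

lemma avoids_123_132_iff:
  assumes "distinct s"
  shows "avoids s [1, 2, 3] \<and> avoids s [1, 3, 2] \<longleftrightarrow> triples (\<lambda>a b c. a < b \<and> a < c) s = 0"
proof -
  have "triples (\<lambda>a b c. a < b \<and> b < c) s + triples (\<lambda>a b c. a < c \<and> c < b) s
      = triples (\<lambda>a b c. a < b \<and> a < c) s"
    using assms by (rule triples_add) auto
  then show ?thesis
    unfolding avoids_def pattern_count_simps by linarith
qed

lemma Av_123_132_eq:
  "Av_123_132 n = {s \<in> permutations_of_set {1..n}. triples (\<lambda>a b c. a < b \<and> a < c) s = 0}"
  unfolding Av_123_132_def using avoids_123_132_iff permutations_of_setD(2) by blast

text \<open>The order isomorphism that frees the value \<open>n\<close> for a new first entry; only
  the maximum has to move.\<close>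

definition bump :: "nat \<Rightarrow> nat \<Rightarrow> nat" where
  "bump n y = (if y = n then Suc n else y)"

lemma bump_less_iff: "a \<le> n \<Longrightarrow> b \<le> n \<Longrightarrow> bump n a < bump n b \<longleftrightarrow> a < b"
  by (auto simp: bump_def)

lemma inj_on_bump: "inj_on (bump n) {1..n}"
  by (auto simp: inj_on_def bump_def split: if_splits)

lemma bump_image: "n \<ge> 1 \<Longrightarrow> bump n ` {1..n} = {1..Suc n} - {n}"
  by (auto simp: bump_def image_iff split: if_splits)

text \<open>The second hypothesis says that \<open>T\<close> sees only the relative order of its
  arguments, and \<open>bump n\<close> preserves that order.\<close>

lemma triples_map_bump:
  assumes "s \<in> permutations_of_set {1..n}"
    and "\<And>a b c a' b' c'. (a < b \<longleftrightarrow> a' < b') \<Longrightarrow> (a < c \<longleftrightarrow> a' < c') \<Longrightarrow> (b < a \<longleftrightarrow> b' < a') \<Longrightarrow>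
      (b < c \<longleftrightarrow> b' < c') \<Longrightarrow> (c < a \<longleftrightarrow> c' < a') \<Longrightarrow> (c < b \<longleftrightarrow> c' < b') \<Longrightarrow> T a b c \<longleftrightarrow> T a' b' c'"
  shows "triples T (map (bump n) s) = triples T s"
  unfolding triples_map
proof (rule triples_cong)
  show "distinct s"
    using permutations_of_setD(2)[OF assms(1)] .
  fix a b c
  assume "a \<in> set s" "b \<in> set s" "c \<in> set s"
  then have "a \<le> n" "b \<le> n" "c \<le> n"
    using permutations_of_setD(1)[OF assms(1)] by auto
  then show "T (bump n a) (bump n b) (bump n c) \<longleftrightarrow> T a b c"
    by (intro assms(2) bump_less_iff)
qed

text \<open>All \<open>Suc n - x\<close> values above \<open>x\<close> stand to its right, and at
  most one of them is allowed.\<close>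

lemma triples_Cons_eq_0_iff:
  assumes "x \<in> {1..Suc n}" "t \<in> permutations_of_set ({1..Suc n} - {x})"
  shows "triples (\<lambda>a b c. a < b \<and> a < c) (x # t) = 0 \<longleftrightarrow>
    n \<le> x \<and> triples (\<lambda>a b c. a < b \<and> a < c) t = 0"
proof -
  have "length (filter ((<) x) t) = card ({y. x < y} \<inter> set t)"
    using permutations_of_setD(2)[OF assms(2)]
    by (simp add: distinct_length_filter Int_commute)
  also have "{y. x < y} \<inter> set t = {x<..Suc n}"
    unfolding permutations_of_setD(1)[OF assms(2)] using assms(1) by auto
  finally have "length (filter ((<) x) t) = Suc n - x"
    by simp
  then have "pairs (\<lambda>b c. x < b \<and> x < c) t = 0 \<longleftrightarrow> n \<le> x"
    unfolding pairs_conj_eq_0 by linarith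
  then show ?thesis by simp
qed

lemma Av_123_132_Suc:
  assumes "n \<ge> 1"
  shows "Av_123_132 (Suc n) =
    (#) (Suc n) ` Av_123_132 n \<union> (\<lambda>t. n # map (bump n) t) ` Av_123_132 n"
proof -
  let ?V = "\<lambda>s :: nat list. triples (\<lambda>a b c. a < b \<and> a < c) s = 0"
  have "Av_123_132 (Suc n) =
      (\<Union>x\<in>{1..Suc n}. (#) x ` {t \<in> permutations_of_set ({1..Suc n} - {x}). ?V (x # t)})"
    unfolding Av_123_132_eq by (subst permutations_of_set_nonempty) auto
  also have "\<dots> = (\<Union>x\<in>{1..Suc n}. (#) x `
      {t \<in> permutations_of_set ({1..Suc n} - {x}). n \<le> x \<and> ?V t})"
    using triples_Cons_eq_0_iff by (intro SUP_cong refl arg_cong2[where f = image]) blast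
  also have "\<dots> = (\<Union>x\<in>{x \<in> {1..Suc n}. n \<le> x}. (#) x `
      {t \<in> permutations_of_set ({1..Suc n} - {x}). ?V t})"
    by blast
  also have "{x \<in> {1..Suc n}. n \<le> x} = {n, Suc n}"
    using assms by auto
  also have "(\<Union>x\<in>{n, Suc n}. (#) x ` {t \<in> permutations_of_set ({1..Suc n} - {x}). ?V t})
      = (#) (Suc n) ` {t \<in> permutations_of_set ({1..Suc n} - {Suc n}). ?V t}
      \<union> (#) n ` {t \<in> permutations_of_set ({1..Suc n} - {n}). ?V t}"
    by blast
  also have "{1..Suc n} - {Suc n} = {1..n}"
    by auto
  \<comment> \<open>For first entry \<open>n\<close>, the remaining entries are a relabelling of a
    permutation of \<open>{1..n}\<close>, and avoidance transfers along it.\<close>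
  also have "permutations_of_set ({1..Suc n} - {n}) = map (bump n) ` permutations_of_set {1..n}"
    unfolding bump_image[OF assms, symmetric] by (rule permutations_of_set_image_inj[OF inj_on_bump])
  also have "{t \<in> map (bump n) ` permutations_of_set {1..n}. ?V t} = map (bump n) ` Av_123_132 n"
    using triples_map_bump[of _ n "\<lambda>a b c. a < b \<and> a < c"] unfolding Av_123_132_eq by auto
  finally show ?thesis
    unfolding Av_123_132_eq by (simp add: image_image)
qed

lemma finite_Av_123_132: "finite (Av_123_132 n)"
  unfolding Av_123_132_def by simp

lemma Av_123_132_1: "Av_123_132 (Suc 0) = {[1]}"
  unfolding Av_123_132_eq by auto

text \<open>The two families differ in their first entry and both maps are injective. Every
  recurrence for a total is an instance of this.\<close>

lemma sum_Av_123_132_Suc: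
  fixes g :: "nat list \<Rightarrow> 'a :: comm_monoid_add"
  assumes "n \<ge> 1"
  shows "sum g (Av_123_132 (Suc n)) =
    (\<Sum>t\<in>Av_123_132 n. g (Suc n # t)) + (\<Sum>t\<in>Av_123_132 n. g (n # map (bump n) t))"
proof -
  have "inj_on (map (bump n)) (Av_123_132 n)"
    by (rule inj_on_mapI, rule inj_on_subset[OF inj_on_bump])
      (auto simp: Av_123_132_def dest: permutations_of_setD)
  then have "inj_on (\<lambda>t. n # map (bump n) t) (Av_123_132 n)"
    by (auto simp: inj_on_def)
  then show ?thesis
    unfolding Av_123_132_Suc[OF assms]
    by (subst sum.union_disjoint) (auto simp: finite_Av_123_132 sum.reindex o_def)
qed

section \<open>Recurrences for the totals\<close>

text \<open>In a permutation of \<open>{1..n}\<close>, this is the 0-based position of the maximum.\<close>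

definition before_max :: "nat \<Rightarrow> nat list \<Rightarrow> nat" where
  "before_max n = pairs (\<lambda>a b. b = n)"

section \<open>Effect of the new first entry on each statistic\<close>

context
  fixes n :: nat and t :: "nat list"
  assumes n: "n \<ge> 1" and t: "t \<in> Av_123_132 n"
begin

private lemma perm_t: "t \<in> permutations_of_set {1..n}"
  using t by (simp add: Av_123_132_def)

private lemma set_t: "set t = {1..n}" and distinct_t: "distinct t" and length_t: "length t = n"
  using permutations_of_setD[OF perm_t] length_finite_permutations_of_set[OF perm_t] by auto

text \<open>Eliminates the number of entries after the maximum, so that only
  \<open>before_max\<close> has to be tracked.\<close>

private lemma after_max: "pairs (\<lambda>a b. a = n) t + before_max n t + 1 = n"
  unfolding before_max_def using pairs_around[OF distinct_t, of n] n set_t length_t by simp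

lemma before_max_Cons: "before_max (Suc n) (Suc n # t) = 0"
proof -
  have "filter (\<lambda>y. y = Suc n) t = []"
    by (auto simp: filter_empty_conv set_t)
  moreover have "pairs (\<lambda>a b. b = Suc n) t = pairs (\<lambda>_ _. False) t"
    by (rule pairs_cong[OF distinct_t]) (auto simp: set_t)
  ultimately show ?thesis by (simp add: before_max_def)
qed

text \<open>The maximum keeps its place in \<open>t\<close> under relabelling and gains the new
  entry \<open>n\<close> in front of it.\<close>

lemma before_max_Cons_bump: "before_max (Suc n) (n # map (bump n) t) = before_max n t + 1"
proof -
  have "filter (\<lambda>y. bump n y = Suc n) t = filter (\<lambda>y. y = n) t"
    by (rule filter_cong) (auto simp: bump_def set_t)
  moreover have "pairs (\<lambda>a b. bump n b = Suc n) t = pairs (\<lambda>a b. b = n) t"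
    by (rule pairs_cong[OF distinct_t]) (auto simp: bump_def set_t)
  ultimately show ?thesis
    using n length_filter_eq[OF distinct_t, of n]
    by (simp add: before_max_def pairs_map filter_map o_def set_t)
qed

lemma ascents_Cons: "pairs (<) (Suc n # t) = pairs (<) t"
  using set_t by (auto simp: filter_empty_conv)

text \<open>Only the relabelled maximum exceeds the new first entry \<open>n\<close>, hence exactly
  one new ascent.\<close>

lemma ascents_Cons_bump: "pairs (<) (n # map (bump n) t) = pairs (<) t + 1"
proof -
  have "filter (\<lambda>y. n < bump n y) t = filter (\<lambda>y. y = n) t"
    by (rule filter_cong) (auto simp: bump_def set_t)
  moreover have "pairs (\<lambda>a b. bump n a < bump n b) t = pairs (<) t"
    by (rule pairs_cong[OF distinct_t]) (auto simp: bump_less_iff set_t)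
  ultimately show ?thesis
    using n length_filter_eq[OF distinct_t, of n]
    by (simp add: pairs_map filter_map o_def set_t)
qed

private lemma descents: "2 * (pairs (>) t + pairs (<) t) + n = n ^ 2"
proof -
  have "pairs (>) t + pairs (<) t = pairs (\<lambda>_ _. True) t"
    by (rule pairs_add[OF distinct_t]) auto
  with pairs_True[of t] length_t show ?thesis by simp
qed

text \<open>Each entry before the maximum forms an ascent with it; the other ascents are those that
  complete a 312 with the first entry \<open>n\<close>.\<close>

private lemma ascents_below_max:
  "pairs (\<lambda>a b. bump n a < bump n b \<and> bump n b < n) t + before_max n t = pairs (<) t"
  unfolding before_max_def
  by (rule pairs_add[OF distinct_t]) (auto simp: bump_def set_t)

text \<open>Each entry after the maximum forms a descent with it; the other descents complete a 321
  with the first entry \<open>n\<close>.\<close>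

private lemma descents_below_max:
  "pairs (\<lambda>a b. bump n b < bump n a \<and> bump n a < n) t + pairs (\<lambda>a b. a = n) t = pairs (>) t"
  by (rule pairs_add[OF distinct_t]) (auto simp: bump_def set_t)

text \<open>The new entry is the largest, so it can only play the letter 3: ascents of
  \<open>t\<close> complete 312 and descents complete 321. Doubling in the last equation avoids
  halving \<open>n ^ 2 - n\<close>.\<close>

lemma pattern_count_Cons:
  "pattern_count [2, 1, 3] (Suc n # t) = pattern_count [2, 1, 3] t"
  "pattern_count [2, 3, 1] (Suc n # t) = pattern_count [2, 3, 1] t"
  "pattern_count [3, 1, 2] (Suc n # t) = pattern_count [3, 1, 2] t + pairs (<) t"
  "2 * pattern_count [3, 2, 1] (Suc n # t) + 2 * pairs (<) t + n
    = 2 * pattern_count [3, 2, 1] t + n ^ 2"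
proof -
  have "pairs (\<lambda>a b. a < Suc n \<and> Suc n < b) t = pairs (\<lambda>_ _. False) t"
    by (rule pairs_cong[OF distinct_t]) (auto simp: set_t)
  then show "pattern_count [2, 1, 3] (Suc n # t) = pattern_count [2, 1, 3] t"
    unfolding pattern_count_simps by simp
  have "pairs (\<lambda>a b. b < Suc n \<and> Suc n < a) t = pairs (\<lambda>_ _. False) t"
    by (rule pairs_cong[OF distinct_t]) (auto simp: set_t)
  then show "pattern_count [2, 3, 1] (Suc n # t) = pattern_count [2, 3, 1] t"
    unfolding pattern_count_simps by simp
  have "pairs (\<lambda>a b. a < b \<and> b < Suc n) t = pairs (<) t"
    by (rule pairs_cong[OF distinct_t]) (auto simp: set_t)
  then show "pattern_count [3, 1, 2] (Suc n # t) = pattern_count [3, 1, 2] t + pairs (<) t"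
    unfolding pattern_count_simps by simp
  have "pairs (\<lambda>a b. b < a \<and> a < Suc n) t = pairs (>) t"
    by (rule pairs_cong[OF distinct_t]) (auto simp: set_t)
  then show "2 * pattern_count [3, 2, 1] (Suc n # t) + 2 * pairs (<) t + n
      = 2 * pattern_count [3, 2, 1] t + n ^ 2"
    using descents unfolding pattern_count_simps by simp
qed

text \<open>As the letter 2, the entry \<open>n\<close> needs the maximum as its 3: entries before
  the maximum give 213, entries after it give 231. As the letter 3, it uses ascents or descents that
  avoid the maximum.\<close>

lemma pattern_count_Cons_bump:
  "pattern_count [2, 1, 3] (n # map (bump n) t) = pattern_count [2, 1, 3] t + before_max n t"
  "pattern_count [2, 3, 1] (n # map (bump n) t) + before_max n t + 1
    = pattern_count [2, 3, 1] t + n"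
  "pattern_count [3, 1, 2] (n # map (bump n) t) + before_max n t
    = pattern_count [3, 1, 2] t + pairs (<) t"
  "2 * pattern_count [3, 2, 1] (n # map (bump n) t) + 2 * pairs (<) t + 3 * n
    = 2 * pattern_count [3, 2, 1] t + n ^ 2 + 2 * before_max n t + 2"
proof -
  have "pairs (\<lambda>a b. bump n a < n \<and> n < bump n b) t = before_max n t"
    unfolding before_max_def by (rule pairs_cong[OF distinct_t]) (auto simp: bump_def set_t)
  moreover have
    "triples (\<lambda>a b c. b < a \<and> a < c) (map (bump n) t) = triples (\<lambda>a b c. b < a \<and> a < c) t"
    by (rule triples_map_bump[OF perm_t]) blast
  ultimately show
    "pattern_count [2, 1, 3] (n # map (bump n) t) = pattern_count [2, 1, 3] t + before_max n t"
    unfolding pattern_count_simps by (simp add: pairs_map)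
  have "pairs (\<lambda>a b. bump n b < n \<and> n < bump n a) t = pairs (\<lambda>a b. a = n) t"
    by (rule pairs_cong[OF distinct_t]) (auto simp: bump_def set_t)
  moreover have
    "triples (\<lambda>a b c. c < a \<and> a < b) (map (bump n) t) = triples (\<lambda>a b c. c < a \<and> a < b) t"
    by (rule triples_map_bump[OF perm_t]) blast
  ultimately show "pattern_count [2, 3, 1] (n # map (bump n) t) + before_max n t + 1
      = pattern_count [2, 3, 1] t + n"
    using after_max unfolding pattern_count_simps by (simp add: pairs_map)
  have "triples (\<lambda>a b c. b < c \<and> c < a) (map (bump n) t) = triples (\<lambda>a b c. b < c \<and> c < a) t"
    by (rule triples_map_bump[OF perm_t]) blast
  then show "pattern_count [3, 1, 2] (n # map (bump n) t) + before_max n t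
      = pattern_count [3, 1, 2] t + pairs (<) t"
    using ascents_below_max unfolding pattern_count_simps by (simp add: pairs_map)
  have "triples (\<lambda>a b c. c < b \<and> b < a) (map (bump n) t) = triples (\<lambda>a b c. c < b \<and> b < a) t"
    by (rule triples_map_bump[OF perm_t]) blast
  then show "2 * pattern_count [3, 2, 1] (n # map (bump n) t) + 2 * pairs (<) t + 3 * n
      = 2 * pattern_count [3, 2, 1] t + n ^ 2 + 2 * before_max n t + 2"
    using after_max descents descents_below_max
    unfolding pattern_count_simps by (simp add: pairs_map)
qed

end

section \<open>Closed forms of the totals, by induction from the single permutation of
  \<open>{1}\<close>\<close>

lemma card_Av_123_132: "card (Av_123_132 (Suc m)) = 2 ^ m"
proof (induction m)
  case (Suc m)
  then show ?case
    using sum_Av_123_132_Suc[of "Suc m" "\<lambda>_. 1 :: nat"] by simp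
qed (simp add: Av_123_132_1)

lemma total_before_max:
  "(\<Sum>t\<in>Av_123_132 (Suc m). real (before_max (Suc m) t)) = 2 ^ m - 1"
proof (induction m)
  case (Suc m)
  then show ?case
    by (simp add: sum_Av_123_132_Suc before_max_Cons before_max_Cons_bump
        sum.distrib card_Av_123_132)
qed (simp add: Av_123_132_1 before_max_def)

text \<open>The total doubles and gains one ascent for each of the \<open>2 ^ m\<close> permutations
  with the smaller first entry.\<close>

lemma total_ascents:
  "(\<Sum>t\<in>Av_123_132 (Suc m). real (pairs (<) t)) = real m * 2 ^ m / 2"
proof (induction m)
  case (Suc m)
  then show ?case
    by (simp add: sum_Av_123_132_Suc ascents_Cons ascents_Cons_bump
        sum.distrib card_Av_123_132 field_simps del: pairs.simps)
qed (simp add: Av_123_132_1)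

lemma real_total_count:
  "real (total_count q n) = (\<Sum>t\<in>Av_123_132 n. real (pattern_count q t))"
  by (simp add: total_count_def)

text \<open>The total doubles and gains the \<open>before_max\<close> total
  \<open>2 ^ m - 1\<close>.\<close>

lemma total_count_213:
  "real (total_count [2, 1, 3] (Suc m)) = (real m - 2) * 2 ^ m / 2 + 1"
proof (induction m)
  case 0
  show ?case unfolding real_total_count pattern_count_simps by (simp add: Av_123_132_1)
next
  case (Suc m)
  then show ?case
    by (simp add: real_total_count sum_Av_123_132_Suc pattern_count_Cons pattern_count_Cons_bump
        sum.distrib total_before_max field_simps
        del: One_nat_def)
qed

lemma total_count_231:
  "real (total_count [2, 3, 1] (Suc m)) = (real m ^ 2 - 3 * real m + 4) * 2 ^ m / 4 - 1"
proof (induction m)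
  case 0
  show ?case unfolding real_total_count pattern_count_simps by (simp add: Av_123_132_1)
next
  case (Suc m)
  \<comment> \<open>Here \<open>real m - real (before_max (Suc m) t)\<close> is the number of
    entries after the maximum of \<open>t\<close>.\<close>
  have "real (pattern_count [2, 3, 1] (Suc m # map (bump (Suc m)) t))
      = real (pattern_count [2, 3, 1] t) + real m - real (before_max (Suc m) t)"
    if "t \<in> Av_123_132 (Suc m)" for t
    using pattern_count_Cons_bump(2)[of "Suc m" t] that by simp
  then have "real (total_count [2, 3, 1] (Suc (Suc m)))
      = 2 * real (total_count [2, 3, 1] (Suc m)) + 2 ^ m * real m - (2 ^ m - 1)"
    by (simp add: real_total_count sum_Av_123_132_Suc pattern_count_Cons sum.distrib
        sum_subtractf total_before_max card_Av_123_132 del: One_nat_def)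
  with Suc show ?case
    by (simp add: field_simps power2_eq_square)
qed

text \<open>Same recurrence as for 231: twice the ascent total equals \<open>real m * 2 ^ m\<close>,
  the term that there comes from the number of permutations.\<close>

lemma total_count_312:
  "real (total_count [3, 1, 2] (Suc m)) = (real m ^ 2 - 3 * real m + 4) * 2 ^ m / 4 - 1"
proof (induction m)
  case 0
  show ?case unfolding real_total_count pattern_count_simps by (simp add: Av_123_132_1)
next
  case (Suc m)
  have "real (pattern_count [3, 1, 2] (Suc m # map (bump (Suc m)) t))
      = real (pattern_count [3, 1, 2] t) + real (pairs (<) t) - real (before_max (Suc m) t)"
    if "t \<in> Av_123_132 (Suc m)" for t
    using pattern_count_Cons_bump(3)[of "Suc m" t] that by simp
  then have "real (total_count [3, 1, 2] (Suc (Suc m)))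
      = 2 * real (total_count [3, 1, 2] (Suc m)) + real m * 2 ^ m - (2 ^ m - 1)"
    by (simp add: real_total_count sum_Av_123_132_Suc pattern_count_Cons sum.distrib
        sum_subtractf total_before_max total_ascents del: One_nat_def)
  with Suc show ?case
    by (simp add: field_simps power2_eq_square)
qed

lemma total_count_321:
  "real (total_count [3, 2, 1] (Suc m)) =
     (real m ^ 3 / 3 - real m ^ 2 + 5 * real m / 3 - 2) * 2 ^ m / 2 + 1"
proof (induction m)
  case 0
  show ?case unfolding real_total_count pattern_count_simps by (simp add: Av_123_132_1)
next
  case (Suc m)
  define M where "M = real m"
  \<comment> \<open>The fraction is the number of all pairs among \<open>m + 1\<close> entries;
    subtracting ascents leaves descents.\<close>
  have "real (pattern_count [3, 2, 1] (Suc (Suc m) # t))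
      = real (pattern_count [3, 2, 1] t) - real (pairs (<) t) + (M ^ 2 + M) / 2"
    if "t \<in> Av_123_132 (Suc m)" for t
    using arg_cong[OF pattern_count_Cons(4)[OF _ that], of real]
    by (simp add: M_def field_simps power2_eq_square)
  \<comment> \<open>Removing the descents from the maximum subtracts \<open>M - before_max\<close>,
    which turns the fraction into "M choose 2".\<close>
  moreover have "real (pattern_count [3, 2, 1] (Suc m # map (bump (Suc m)) t))
      = real (pattern_count [3, 2, 1] t) - real (pairs (<) t) + real (before_max (Suc m) t)
        + (M ^ 2 - M) / 2"
    if "t \<in> Av_123_132 (Suc m)" for t
    using arg_cong[OF pattern_count_Cons_bump(4)[OF _ that], of real]
    by (simp add: M_def field_simps power2_eq_square)
  \<comment> \<open>The two fractions add up to \<open>M ^ 2\<close>, and the ascent total is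
    subtracted twice.\<close>
  ultimately have "real (total_count [3, 2, 1] (Suc (Suc m)))
      = 2 * real (total_count [3, 2, 1] (Suc m)) - M * 2 ^ m + (2 ^ m - 1) + 2 ^ m * M ^ 2"
    by (simp add: real_total_count sum_Av_123_132_Suc sum.distrib sum_subtractf
        total_before_max total_ascents card_Av_123_132 flip: M_def del: One_nat_def)
      (simp add: field_simps)
  with Suc show ?case
    by (simp add: M_def field_simps power2_eq_square power3_eq_cube)
qed

theorem theorem2p7:
  fixes n :: nat
  assumes "n \<ge> 3"
  shows "real (total_count [2, 1, 3] n) = (real n - 3) * 2 ^ (n - 2) + 1
    \<and> total_count [2, 3, 1] n = total_count [3, 1, 2] n
    \<and> real (total_count [3, 1, 2] n) = (real n ^ 2 - 5 * real n + 8) * 2 ^ (n - 3) - 1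
    \<and> real (total_count [3, 2, 1] n) =
        (real n ^ 3 / 3 - 2 * real n ^ 2 + 14 * real n / 3 - 5) * 2 ^ (n - 2) + 1"
proof -
  \<comment> \<open>Writing \<open>n\<close> as \<open>k + 3\<close> turns the exponents
    \<open>n - 2\<close> and \<open>n - 3\<close> into \<open>k + 1\<close> and \<open>k\<close>;
    the closed forms are used at \<open>m = n - 1 = k + 2\<close>.\<close>
  from assms obtain k where n: "n = Suc (Suc (Suc k))"
    by (metis add.commute le_Suc_ex plus_nat.simps numeral_3_eq_3)
  have "total_count [2, 3, 1] n = total_count [3, 1, 2] n"
    unfolding n using total_count_231[of "Suc (Suc k)"] total_count_312[of "Suc (Suc k)"]
    by linarith
  then show ?thesis
    using total_count_213[of "Suc (Suc k)"] total_count_312[of "Suc (Suc k)"]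
      total_count_321[of "Suc (Suc k)"]
    by (simp add: n numeral_3_eq_3 field_simps power2_eq_square del: One_nat_def)
qed

end
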